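(* Let $n\ge2$, $0<s<1$, $0<p,q<\infty$ with $sp\ge n$. Then there exists a continuous function $u:\mathbb{R}^n\to\mathbb{R}$ in $\dot{W}^{s,p}_q(\mathbb{R}^n)$ such that for every curve (continuous map) $\gamma:[0,\infty)\to\mathbb{R}^n$ with $\gamma(0)=0$ and $\lim_{t\to\infty}\gamma(t)=\infty$ (i.e. $|\gamma(t)|\to\infty$) we have $$\lim_{t\to\infty}u(\gamma(t))=\infty.$$
   Context: $u\in\dot{W}^{s,p}_q(\mathbb{R}^n)$ means that $u:\mathbb{R}^n\to\mathbb{R}$ is measurable and $\int_{\mathbb{R}^n}\Big(\int_{\mathbb{R}^n}\frac{|u(x)-u(y)|^q}{|x-y|^{n+sq}}\,dy\Big)^{p/q}dx<\infty$. *)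

theory Defs
  imports "HOL-Analysis.Analysis"
begin

text \<open>
  Powers of extended nonnegative reals, for exponents \<open>a > 0\<close> only: then \<open>\<infinity>\<close> to the
  power \<open>a\<close> is \<open>\<infinity>\<close> and \<open>0\<close> to the power \<open>a\<close> is \<open>0\<close>.
\<close>
definition ennreal_powr :: "ennreal \<Rightarrow> real \<Rightarrow> ennreal" where
  "ennreal_powr x a = (if x = \<infinity> then \<infinity> else ennreal (enn2real x powr a))"

text \<open>
  The space of Lebesgue measurable functions with finite homogeneous \<open>W\<^sup>s\<close>-energy
  with exponents \<open>p\<close> and \<open>q\<close>, where \<open>p\<close> belongs to the outer and \<open>q\<close> to the inner integral.
  The integrand is \<open>0/0 = 0\<close> at \<open>y = x\<close>, which for every \<open>x\<close> is a null set of \<open>y\<close>.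
\<close>
definition homogeneous_W :: "real \<Rightarrow> real \<Rightarrow> real \<Rightarrow> (real ^ 'n \<Rightarrow> real) set" where
  "homogeneous_W s p q =
    {u. u \<in> borel_measurable lebesgue \<and>
        (\<integral>\<^sup>+ x. ennreal_powr
           (\<integral>\<^sup>+ y. ennreal (\<bar>u x - u y\<bar> powr q / norm (x - y) powr (real CARD('n) + s * q))
              \<partial>lebesgue)
           (p / q) \<partial>lebesgue) < \<infinity>}"

end

theory Submission
  imports Defs
begin

text \<open>
  The function \<open>u x = sqrt (1 + ln (1 + norm x))\<close> works, because it tends to infinity at
  infinity: the behaviour along a curve is then immediate, and only the finiteness of the energy
  needs an argument. On a dyadic annulus of radius \<open>2 ^ k\<close> this \<open>u\<close> oscillates by about
  \<open>k powr (- 1/2)\<close>, and by scaling the annulus contributes at most a constant times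
  \<open>2 ^ (k * (n - s * p)) * k powr (- p/2)\<close> to the energy. The first factor is bounded since
  \<open>s * p \<ge> n\<close>, and the second is summable since \<open>p > s * p \<ge> n \<ge> 2\<close>. A plain logarithm would
  fail in the critical case \<open>s * p = n\<close>.

  Write \<open>r = 1 + norm x\<close> and \<open>a = 1 + norm y\<close>. The advantage of the square root is the bound
  \<open>\<bar>u x - u y\<bar> \<le> (1 + ln r) powr (- 1/2) * \<bar>ln r - ln a\<bar>\<close> (\<open>sqrt_log_diff_le\<close>), in which
  the slowly varying factor depends on \<open>x\<close> only and leaves the inner integral. What remains there
  is the scale invariant quantity \<open>\<bar>ln r - ln a\<bar> powr q\<close>, whose integral against the kernel
  \<open>1 / dist x y powr (n + s * q)\<close> is at most a constant times \<open>r powr (- (s * q))\<close>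
  (\<open>nn_integral_log_ratio_bound\<close>). Raised to the power \<open>p / q\<close>, this bounds the energy by the
  integral of \<open>r powr (- n) * (1 + ln r) powr (- p/2)\<close> over the space, and this integral is finite
  (\<open>nn_integral_log_weight_finite\<close>). All integrals over the space are computed in polar
  coordinates (\<open>nn_integral_dist\<close>).
\<close>

section \<open>Integration in polar coordinates\<close>

text \<open>
  The surface area of the sphere of radius \<open>r\<close>, extended by \<open>0\<close> to negative \<open>r\<close> so that it is a
  density on the whole real line.
\<close>

definition sphere_density :: "'a::euclidean_space itself \<Rightarrow> real \<Rightarrow> real" where
  "sphere_density _ r = indicator {0..} r * (real DIM('a) * unit_ball_vol DIM('a) * r ^ (DIM('a) - 1))"

lemma sphere_density_measurable [measurable]:
  "sphere_density TYPE('a::euclidean_space) \<in> borel_measurable borel"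
  unfolding sphere_density_def [abs_def] by measurable

text \<open>
  Two measures on the line that are finite and agree on all half-lines are equal, and on the
  half-line up to \<open>a\<close> both sides give the volume of a ball of radius \<open>a\<close>.
\<close>
lemma distr_dist_lborel:
  fixes c :: "'a::euclidean_space"
  shows "distr lborel borel (dist c) = density lborel (sphere_density TYPE('a))"
proof (rule measure_eqI_generator_eq[where E = "range atMost" and \<Omega> = UNIV and A = "\<lambda>i. {..real i}"])
  show "Int_stable (range (atMost :: real \<Rightarrow> _))"
    by (auto simp: Int_stable_def)
next
  fix X :: "real set" assume "X \<in> range atMost"
  then obtain a where X: "X = {..a}" by auto
  have "emeasure (distr lborel borel (dist c)) X = emeasure lborel (cball c a)"
    by (subst emeasure_distr) (auto simp: X cball_def vimage_def)
  also have "\<dots> = (\<integral>\<^sup>+ r. ennreal (sphere_density TYPE('a) r) * indicator X r \<partial>lborel)"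
  proof (cases "0 \<le> a")
    case True
    let ?n = "DIM('a)"
    have "(\<integral>\<^sup>+ r. ennreal (sphere_density TYPE('a) r) * indicator X r \<partial>lborel) =
      (\<integral>\<^sup>+ r. ennreal (real ?n * unit_ball_vol ?n * r ^ (?n - 1)) * indicator {0..a} r \<partial>lborel)"
      by (intro nn_integral_cong) (auto simp: sphere_density_def indicator_def X)
    also have "\<dots> = ennreal (unit_ball_vol ?n * a ^ ?n - unit_ball_vol ?n * 0 ^ ?n)"
      using True by (intro nn_integral_FTC_Icc) (auto intro!: derivative_eq_intros)
    also have "\<dots> = emeasure lborel (cball c a)"
      using True by (simp add: emeasure_cball)
    finally show ?thesis ..
  next
    case False
    then have "(\<lambda>r. ennreal (sphere_density TYPE('a) r) * indicator X r) = (\<lambda>_. 0)"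
      by (auto simp: sphere_density_def indicator_def X)
    with False show ?thesis by simp
  qed
  also have "\<dots> = emeasure (density lborel (sphere_density TYPE('a))) X"
    by (subst emeasure_density) (auto simp: X)
  finally show "emeasure (distr lborel borel (dist c)) X =
    emeasure (density lborel (sphere_density TYPE('a))) X" .
next
  show "sets (distr lborel borel (dist c)) = sigma_sets UNIV (range atMost)"
    "sets (density lborel (sphere_density TYPE('a))) = sigma_sets UNIV (range atMost)"
    by (simp_all add: borel_eq_atMost)
next
  show "(\<Union>i. {..real i}) = UNIV"
    by (auto simp: real_arch_simple)
next
  fix i
  have "emeasure (distr lborel borel (dist c)) {..real i} = emeasure lborel (cball c (real i))"
    by (subst emeasure_distr) (auto simp: cball_def vimage_def)
  then show "emeasure (distr lborel borel (dist c)) {..real i} \<noteq> \<infinity>"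
    by (simp add: emeasure_cball)
qed auto

corollary nn_integral_dist:
  fixes c :: "'a::euclidean_space"
  assumes [measurable]: "f \<in> borel_measurable borel"
  shows "(\<integral>\<^sup>+ x. f (dist c x) \<partial>lborel) =
    (\<integral>\<^sup>+ r. ennreal (sphere_density TYPE('a) r) * f r \<partial>lborel)"
proof -
  have "(\<integral>\<^sup>+ x. f (dist c x) \<partial>lborel) = (\<integral>\<^sup>+ r. f r \<partial>distr lborel borel (dist c))"
    by (subst nn_integral_distr) auto
  then show ?thesis
    unfolding distr_dist_lborel by (simp add: nn_integral_density)
qed

text \<open>
  The exponent is written as \<open>\<alpha> - DIM('a)\<close> because the power \<open>DIM('a) - 1\<close> from the sphere then
  cancels to the one-dimensional exponent \<open>\<alpha> - 1\<close>.
\<close>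
lemma nn_integral_dist_powr:
  fixes c :: "'a::euclidean_space"
  assumes I: "((\<lambda>r. r powr (\<alpha> - 1)) has_integral J) S" and S: "S \<in> sets borel" "S \<subseteq> {0..}"
  shows "(\<integral>\<^sup>+ x. ennreal (dist c x powr (\<alpha> - real DIM('a))) * indicator S (dist c x) \<partial>lborel) =
    ennreal (real DIM('a) * unit_ball_vol DIM('a) * J)"
proof -
  note [measurable] = S(1)
  let ?K = "real DIM('a) * unit_ball_vol DIM('a)"
  have "(\<integral>\<^sup>+ x. ennreal (dist c x powr (\<alpha> - real DIM('a))) * indicator S (dist c x) \<partial>lborel) =
    (\<integral>\<^sup>+ r. ennreal (sphere_density TYPE('a) r) * (ennreal (r powr (\<alpha> - real DIM('a))) * indicator S r) \<partial>lborel)"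
    by (intro nn_integral_dist) measurable
  also have "\<dots> = (\<integral>\<^sup>+ r. ennreal ?K * ennreal (indicator S r * r powr (\<alpha> - 1)) \<partial>lborel)"
  proof (rule nn_integral_cong)
    fix r :: real
    have "r ^ (DIM('a) - 1) * r powr (\<alpha> - real DIM('a)) = r powr (\<alpha> - 1)" if "r \<ge> 0"
    proof (cases "r = 0")
      case False
      have "r ^ (DIM('a) - 1) = r powr (real DIM('a) - 1)"
        using False that by (simp add: powr_realpow[symmetric] of_nat_diff)
      then show ?thesis by (simp add: powr_add[symmetric])
    qed simp
    then show "ennreal (sphere_density TYPE('a) r) * (ennreal (r powr (\<alpha> - real DIM('a))) * indicator S r) =
      ennreal ?K * ennreal (indicator S r * r powr (\<alpha> - 1))"
      using S by (auto simp: sphere_density_def indicator_def ennreal_mult[symmetric] mult.assoc)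
  qed
  also have "\<dots> = ennreal ?K * (\<integral>\<^sup>+ r. ennreal (indicator S r * r powr (\<alpha> - 1)) \<partial>lborel)"
    by (rule nn_integral_cmult) measurable
  also have "\<dots> = ennreal ?K * ennreal J"
    using nn_integral_has_integral_lebesgue[OF _ I] by simp
  also have "\<dots> = ennreal (?K * J)"
    using has_integral_nonneg[OF I] by (simp add: ennreal_mult)
  finally show ?thesis .
qed

lemma nn_integral_dist_powr_cball:
  fixes c :: "'a::euclidean_space"
  assumes "\<alpha> > 0" "R \<ge> 0"
  shows "(\<integral>\<^sup>+ x. ennreal (dist c x powr (\<alpha> - real DIM('a))) * indicator {0..R} (dist c x) \<partial>lborel) =
    ennreal (real DIM('a) * unit_ball_vol DIM('a) * (R powr \<alpha> / \<alpha>))"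
  using has_integral_powr_from_0[of "\<alpha> - 1" R] assms by (intro nn_integral_dist_powr) auto

lemma nn_integral_dist_powr_outside:
  fixes c :: "'a::euclidean_space"
  assumes "\<beta> > 0" "R > 0"
  shows "(\<integral>\<^sup>+ x. ennreal (dist c x powr (- \<beta> - real DIM('a))) * indicator {R..} (dist c x) \<partial>lborel) =
    ennreal (real DIM('a) * unit_ball_vol DIM('a) * (R powr (- \<beta>) / \<beta>))"
  using has_integral_powr_to_inf[of "- \<beta> - 1" R] assms by (intro nn_integral_dist_powr) auto

text \<open>
  The mean of \<open>r / (1 + norm y)\<close> over the ball of radius \<open>r\<close> is bounded uniformly in \<open>r\<close>, because
  even the singular majorant \<open>r / norm y\<close> is integrable in dimension at least two.
\<close>
lemma nn_integral_inverse_ball_le: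
  assumes "DIM('a::euclidean_space) \<ge> 2" "r \<ge> 0"
  shows "(\<integral>\<^sup>+ y. ennreal (r / (1 + norm (y :: 'a))) * indicator {0..r} (norm y) \<partial>lborel)
    \<le> ennreal (real DIM('a) * unit_ball_vol DIM('a) * r ^ DIM('a))"
proof -
  let ?K = "real DIM('a) * unit_ball_vol DIM('a)"
  let ?f = "\<lambda>\<rho>. ennreal (r / (1 + \<rho>)) * indicator {0..r} \<rho>"
  obtain m where m: "DIM('a) = Suc (Suc m)"
    using that[of "DIM('a) - 2"] assms(1) by simp
  have "(\<integral>\<^sup>+ y. ?f (norm (y :: 'a)) \<partial>lborel) = (\<integral>\<^sup>+ y. ?f (dist (0 :: 'a) y) \<partial>lborel)"
    by simp
  also have "\<dots> = (\<integral>\<^sup>+ \<rho>. ennreal (sphere_density TYPE('a) \<rho>) * ?f \<rho> \<partial>lborel)"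
    by (rule nn_integral_dist) measurable
  also have "\<dots> \<le> (\<integral>\<^sup>+ \<rho>. ennreal (?K * r ^ (DIM('a) - 1)) * indicator {0..r} \<rho> \<partial>lborel)"
  proof (rule nn_integral_mono)
    fix \<rho> :: real
    have "\<rho> ^ Suc m * (r / (1 + \<rho>)) \<le> r ^ Suc m" if "0 \<le> \<rho>" "\<rho> \<le> r"
    proof -
      have "\<rho> ^ Suc m * (r / (1 + \<rho>)) = (\<rho> / (1 + \<rho>)) * (r * \<rho> ^ m)"
        by simp
      also have "\<dots> \<le> 1 * (r * r ^ m)"
        using that by (intro mult_mono power_mono) (auto simp: divide_simps)
      finally show ?thesis by simp
    qed
    from mult_left_mono[OF this, of ?K]
    show "ennreal (sphere_density TYPE('a) \<rho>) * ?f \<rho> \<le> ennreal (?K * r ^ (DIM('a) - 1)) * indicator {0..r} \<rho>"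
      using assms by (cases "0 \<le> \<rho> \<and> \<rho> \<le> r")
        (auto simp: m sphere_density_def indicator_def ennreal_mult[symmetric] mult_ac intro!: ennreal_leI)
  qed
  also have "\<dots> = ennreal (?K * r ^ (DIM('a) - 1)) * ennreal r"
    using assms by (simp add: nn_integral_cmult_indicator)
  also have "\<dots> = ennreal (?K * r ^ DIM('a))"
    using assms by (simp add: ennreal_mult[symmetric] m mult_ac)
  finally show ?thesis .
qed


section \<open>The inner integral of a logarithmic ratio\<close>

text \<open>
  In the application \<open>r = 1 + norm x\<close>, \<open>a = 1 + norm y\<close> and \<open>t = dist x y\<close>. The three terms cover
  three regimes. For \<open>t\<close> small against \<open>r\<close> the logarithm is Lipschitz with constant \<open>2 / r\<close>,
  which compensates the singularity of the kernel at \<open>y = x\<close> as \<open>s < 1\<close>. For \<open>t\<close> large and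
  \<open>a \<ge> r\<close> the logarithm is below a multiple of the power \<open>s / 2\<close> of \<open>t / r\<close>, and any power
  below \<open>s\<close> keeps the kernel integrable at infinity. For \<open>t\<close> large and \<open>a < r\<close> the logarithm is
  unbounded as \<open>r\<close> grows with \<open>y\<close> near the origin; its power \<open>q\<close> is at most a multiple of
  \<open>r / a\<close>, whose mean over the ball of radius \<open>r\<close> around the origin is bounded.
\<close>
lemma log_ratio_bound:
  fixes r a t s q :: real
  assumes "1 \<le> r" "1 \<le> a" "\<bar>r - a\<bar> \<le> t" "0 < s" "0 < q"
  shows "\<bar>ln r - ln a\<bar> powr q \<le>
    (2 / r) powr q * (t powr q * indicator {0..r/2} t)
    + (2 / s) powr q * (3 / r) powr (s*q/2) * (t powr (s*q/2) * indicator {r/2..} t)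
    + q powr q * (r / a) * indicator {0..r} (a - 1) * indicator {r/2..} t"
    (is "_ \<le> ?A + ?B + ?C")
proof -
  have t: "t \<ge> 0" using assms by linarith
  have nonneg: "?A \<ge> 0" "?B \<ge> 0" "?C \<ge> 0"
    using assms by (auto simp: indicator_def)
  consider "t \<le> r/2" | "t > r/2" "a \<ge> r" | "t > r/2" "a < r" by linarith
  then have "\<bar>ln r - ln a\<bar> powr q \<le> ?A \<or> \<bar>ln r - ln a\<bar> powr q \<le> ?B \<or> \<bar>ln r - ln a\<bar> powr q \<le> ?C"
  proof cases
    case 1
    have ln: "ln x - ln y \<le> 2 * t / r" if "x \<ge> y" "x - y \<le> t" "y \<ge> r/2" for x y
    proof -
      have y: "y > 0" using that assms by linarith
      have "ln x - ln y \<le> (x - y) / y"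
        using ln_diff_le[of x y] that y by simp
      also have "\<dots> \<le> t / (r/2)"
        using that assms by (intro frac_le) auto
      finally show ?thesis by (simp add: mult.commute)
    qed
    have "\<bar>ln r - ln a\<bar> \<le> 2 * t / r"
      using ln[of r a] ln[of a r] assms 1 by (cases "r \<le> a") auto
    then have "\<bar>ln r - ln a\<bar> powr q \<le> (2 / r * t) powr q"
      using assms by (intro powr_mono2) auto
    also have "\<dots> = (2 / r) powr q * t powr q"
      by (rule powr_mult)
    also have "\<dots> = ?A"
      using 1 t by simp
    finally show ?thesis by simp
  next
    case 2
    have "\<bar>ln r - ln a\<bar> = ln (a / r)"
      using 2 assms by (simp add: ln_div)
    also have "\<dots> \<le> (a / r) powr (s/2) / (s/2)"
      using 2 assms by (intro ln_powr_bound) auto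
    also have "\<dots> \<le> (3 / r * t) powr (s/2) / (s/2)"
      using 2 assms by (intro divide_right_mono powr_mono2) (auto simp: divide_simps)
    finally have "\<bar>ln r - ln a\<bar> powr q \<le> ((2/s) * (3 / r * t) powr (s/2)) powr q"
      using assms by (intro powr_mono2) (auto simp: mult.commute)
    also have "\<dots> = (2/s) powr q * ((3 / r) powr (s/2*q) * t powr (s/2*q))"
      by (simp only: powr_mult powr_powr)
    also have "\<dots> = ?B"
      using 2 by simp
    finally show ?thesis by simp
  next
    case 3
    have "\<bar>ln r - ln a\<bar> = ln (r / a)"
      using 3 assms by (simp add: ln_div)
    then have "\<bar>ln r - ln a\<bar> powr q \<le> q powr q * (r / a)"
      using 3 assms ln_powr_bound2[of "r/a" q] by simp
    also have "\<dots> = ?C"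
      using assms 3 by simp
    finally show ?thesis by simp
  qed
  with nonneg show ?thesis by linarith
qed

text \<open>
  Up to the value of \<open>C\<close> this is what scaling predicts. Each of the three terms of
  \<open>log_ratio_bound\<close> is integrated against the kernel, over a ball around \<open>x\<close>, outside a ball around
  \<open>x\<close>, and over a ball around the origin, and each gives at most a multiple of
  \<open>(1 + norm x) powr (- (s * q))\<close>.
\<close>
lemma nn_integral_log_ratio_bound:
  assumes dim: "DIM('a::euclidean_space) \<ge> 2" and s: "0 < s" "s < 1" and q: "0 < q"
  obtains C where "0 \<le> C" and
    "\<And>x :: 'a. (\<integral>\<^sup>+ y. ennreal (\<bar>ln (1 + norm x) - ln (1 + norm y)\<bar> powr q
        / dist x y powr (real DIM('a) + s * q)) \<partial>lborel) \<le> ennreal (C * (1 + norm x) powr (- (s * q)))"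
proof -
  let ?n = "real DIM('a)"
  let ?N = "?n + s * q"
  define K where "K = ?n * unit_ball_vol ?n"
  have K: "K \<ge> 0" by (simp add: K_def)
  define \<alpha> where "\<alpha> = (1 - s) * q"
  define \<beta> where "\<beta> = s * q / 2"
  have pos: "\<alpha> > 0" "\<beta> > 0" using s q by (simp_all add: \<alpha>_def \<beta>_def)
  define C where "C = 2 powr (s*q) * K / \<alpha> + (2 / s) powr q * 6 powr \<beta> * K / \<beta> + q powr q * 2 powr ?N * K"
  show thesis
  proof (rule that)
    show "0 \<le> C" using K pos s q by (simp add: C_def)
    fix x :: 'a
    define r where "r = 1 + norm x"
    have r: "r \<ge> 1" by (simp add: r_def)
    define c1 where "c1 = (2 / r) powr q"
    define c2 where "c2 = (2 / s) powr q * (3 / r) powr \<beta>"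
    define c3 where "c3 = q powr q * (2 / r) powr ?N"
    have c: "c1 \<ge> 0" "c2 \<ge> 0" "c3 \<ge> 0" using s q by (simp_all add: c1_def c2_def c3_def)
    \<comment> \<open>The left-hand sides are what the three integrals below evaluate or are bounded to.\<close>
    have eq1: "c1 * (K * ((r/2) powr \<alpha> / \<alpha>)) = 2 powr (s*q) * K / \<alpha> * r powr (- (s*q))"
    proof -
      have "(2 / r) powr q * (r/2) powr \<alpha> = (2 / r) powr (s * q)"
      proof -
        have "(r/2) powr \<alpha> = (2 / r) powr (- \<alpha>)"
          using r by (simp add: powr_minus_divide powr_divide)
        then have "(2 / r) powr q * (r/2) powr \<alpha> = (2 / r) powr (q + - \<alpha>)"
          by (simp only: powr_add)
        also have "q + - \<alpha> = s * q" by (simp add: \<alpha>_def algebra_simps)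
        finally show ?thesis .
      qed
      moreover have "(2 / r) powr (s * q) = 2 powr (s * q) * r powr (- (s * q))"
        using r by (simp add: powr_divide powr_minus_divide)
      ultimately show ?thesis by (simp add: c1_def mult.assoc mult.left_commute)
    qed
    have eq2: "c2 * (K * ((r/2) powr (- \<beta>) / \<beta>)) = (2 / s) powr q * 6 powr \<beta> * K / \<beta> * r powr (- (s*q))"
    proof -
      have "(3 / r) powr \<beta> * (r/2) powr (- \<beta>) = 6 powr \<beta> * r powr (- (s * q))"
      proof -
        have "(3 / r) powr \<beta> = 3 powr \<beta> * r powr (- \<beta>)"
          by (simp add: powr_minus_divide powr_divide)
        moreover have "(r/2) powr (- \<beta>) = 2 powr \<beta> * r powr (- \<beta>)"
          by (simp add: powr_minus_divide powr_divide)
        moreover have "r powr (- (s * q)) = r powr (- \<beta>) * r powr (- \<beta>)"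
          by (subst powr_add[symmetric]) (simp add: \<beta>_def mult.commute)
        moreover have "(6::real) powr \<beta> = 3 powr \<beta> * 2 powr \<beta>"
          using powr_mult[of 3 2 \<beta>] by simp
        ultimately show ?thesis by (simp only: mult_ac)
      qed
      then show ?thesis by (simp add: c2_def mult_ac)
    qed
    have eq3: "c3 * (K * r ^ DIM('a)) = q powr q * 2 powr ?N * K * r powr (- (s*q))"
    proof -
      have "(2 / r) powr ?N * r ^ DIM('a) = 2 powr ?N * r powr (- (s*q))"
      proof -
        have "r ^ DIM('a) = r powr ?n" using r by (simp add: powr_realpow)
        moreover have "(2 / r) powr ?N = 2 powr ?N * r powr (- ?N)"
          unfolding powr_divide powr_minus_divide by simp
        moreover have "r powr (- ?N) * r powr ?n = r powr (- (s*q))"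
          by (subst powr_add[symmetric]) simp
        ultimately show ?thesis by simp
      qed
      then show ?thesis by (simp add: c3_def mult_ac)
    qed
    let ?f1 = "\<lambda>y. ennreal (dist x y powr (\<alpha> - ?n)) * indicator {0..r/2} (dist x y)"
    let ?f2 = "\<lambda>y. ennreal (dist x y powr (- \<beta> - ?n)) * indicator {r/2..} (dist x y)"
    let ?f3 = "\<lambda>y :: 'a. ennreal (r / (1 + norm y)) * indicator {0..r} (norm y)"
    have "(\<integral>\<^sup>+ y. ennreal (\<bar>ln r - ln (1 + norm y)\<bar> powr q / dist x y powr ?N) \<partial>lborel)
      \<le> (\<integral>\<^sup>+ y. ennreal c1 * ?f1 y + ennreal c2 * ?f2 y + ennreal c3 * ?f3 y \<partial>lborel)"
    proof (rule nn_integral_mono)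
      fix y :: 'a
      define t where "t = dist x y"
      define a where "a = 1 + norm y"
      have a: "a \<ge> 1" by (simp add: a_def)
      have "\<bar>r - a\<bar> \<le> t"
        using norm_triangle_ineq3[of x y] by (simp add: r_def a_def t_def dist_norm)
      note bound = log_ratio_bound[OF r a this s(1) q]
      have "\<bar>ln r - ln a\<bar> powr q / t powr ?N \<le>
         (c1 * (t powr q * indicator {0..r/2} t) + c2 * (t powr \<beta> * indicator {r/2..} t)
         + q powr q * (r / a) * indicator {0..r} (a - 1) * indicator {r/2..} t) / t powr ?N"
        using bound by (intro divide_right_mono) (auto simp: c1_def c2_def \<beta>_def)
      also have "\<dots> = c1 * (t powr (\<alpha> - ?n) * indicator {0..r/2} t) + c2 * (t powr (- \<beta> - ?n) * indicator {r/2..} t)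
         + q powr q * (indicator {r/2..} t / t powr ?N) * (r / a * indicator {0..r} (a - 1))"
      proof -
        have "\<alpha> - ?n = q - ?N" "- \<beta> - ?n = \<beta> - ?N"
          by (simp_all add: \<alpha>_def \<beta>_def algebra_simps)
        then have "t powr (\<alpha> - ?n) = t powr q / t powr ?N" "t powr (- \<beta> - ?n) = t powr \<beta> / t powr ?N"
          by (simp_all only: powr_diff)
        then show ?thesis by (simp add: add_divide_distrib mult_ac)
      qed
      also have "\<dots> \<le> c1 * (t powr (\<alpha> - ?n) * indicator {0..r/2} t) + c2 * (t powr (- \<beta> - ?n) * indicator {r/2..} t)
         + c3 * (r / a * indicator {0..r} (a - 1))"
      proof -
        \<comment> \<open>Far from \<open>x\<close> the kernel is at most its value at distance \<open>r / 2\<close>.\<close>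
        have "indicator {r/2..} t / t powr ?N \<le> (2 / r) powr ?N"
        proof (cases "r/2 \<le> t")
          case True
          have "1 / t powr ?N = (1 / t) powr ?N"
            using r True by (simp add: powr_divide)
          also have "\<dots> \<le> (2 / r) powr ?N"
            using r True s q by (intro powr_mono2) (auto simp: divide_simps)
          finally show ?thesis using True by simp
        qed simp
        then show ?thesis
          unfolding c3_def using r a q by (intro add_left_mono mult_right_mono mult_left_mono) auto
      qed
      finally have "ennreal (\<bar>ln r - ln a\<bar> powr q / t powr ?N) \<le> ennreal \<dots>"
        by (rule ennreal_leI)
      also have "\<dots> = ennreal c1 * (ennreal (t powr (\<alpha> - ?n)) * indicator {0..r/2} t)
         + ennreal c2 * (ennreal (t powr (- \<beta> - ?n)) * indicator {r/2..} t)
         + ennreal c3 * (ennreal (r / a) * indicator {0..r} (a - 1))"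
      proof -
        have "ennreal (z * (w * indicator S v)) = ennreal z * (ennreal w * indicator S v)"
          if "0 \<le> z" "0 \<le> w" for z w v :: real and S
          using that by (simp add: indicator_def ennreal_mult)
        with c r a show ?thesis by (simp add: ennreal_plus del: times_divide_eq_left times_divide_eq_right)
      qed
      finally show "ennreal (\<bar>ln r - ln (1 + norm y)\<bar> powr q / dist x y powr ?N)
        \<le> ennreal c1 * ?f1 y + ennreal c2 * ?f2 y + ennreal c3 * ?f3 y"
        by (simp add: a_def t_def)
    qed
    also have "\<dots> = ennreal c1 * (\<integral>\<^sup>+ y. ?f1 y \<partial>lborel) + ennreal c2 * (\<integral>\<^sup>+ y. ?f2 y \<partial>lborel)
        + ennreal c3 * (\<integral>\<^sup>+ y. ?f3 y \<partial>lborel)"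
    proof -
      have [measurable]: "?f1 \<in> borel_measurable lborel" "?f2 \<in> borel_measurable lborel"
        "?f3 \<in> borel_measurable lborel"
        by measurable
      show ?thesis by (simp add: nn_integral_add nn_integral_cmult)
    qed
    also have "\<dots> \<le> ennreal c1 * ennreal (K * ((r/2) powr \<alpha> / \<alpha>))
        + ennreal c2 * ennreal (K * ((r/2) powr (- \<beta>) / \<beta>)) + ennreal c3 * ennreal (K * r ^ DIM('a))"
    proof -
      have "(\<integral>\<^sup>+ y. ?f1 y \<partial>lborel) = ennreal (K * ((r/2) powr \<alpha> / \<alpha>))"
        unfolding K_def using r pos by (intro nn_integral_dist_powr_cball) auto
      moreover have "(\<integral>\<^sup>+ y. ?f2 y \<partial>lborel) = ennreal (K * ((r/2) powr (- \<beta>) / \<beta>))"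
        unfolding K_def using r pos by (intro nn_integral_dist_powr_outside) auto
      moreover have "(\<integral>\<^sup>+ y. ?f3 y \<partial>lborel) \<le> ennreal (K * r ^ DIM('a))"
        unfolding K_def using r dim by (intro nn_integral_inverse_ball_le) auto
      ultimately show ?thesis by (simp add: mult_left_mono)
    qed
    also have "\<dots> = ennreal (c1 * (K * ((r/2) powr \<alpha> / \<alpha>)) + c2 * (K * ((r/2) powr (- \<beta>) / \<beta>)) + c3 * (K * r ^ DIM('a)))"
      using c K pos r
      by (simp add: ennreal_plus ennreal_mult del: times_divide_eq_left times_divide_eq_right)
    also have "\<dots> = ennreal (C * r powr (- (s * q)))"
      unfolding eq1 eq2 eq3 by (simp add: C_def algebra_simps)
    finally show "(\<integral>\<^sup>+ y. ennreal (\<bar>ln (1 + norm x) - ln (1 + norm y)\<bar> powr q / dist x y powr ?N) \<partial>lborel)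
        \<le> ennreal (C * (1 + norm x) powr (- (s * q)))"
      by (simp add: r_def)
  qed
qed

section \<open>The outer integral\<close>

text \<open>
  In polar coordinates the integrand is at most a multiple of
  \<open>(1 + ln (1 + r)) powr (- b) / (1 + r)\<close>, the derivative of a multiple of
  \<open>(1 + ln (1 + r)) powr (1 - b)\<close>, which vanishes at infinity because \<open>b > 1\<close>.
\<close>
lemma nn_integral_log_weight_finite:
  assumes "b > 1"
  shows "(\<integral>\<^sup>+ x. ennreal ((1 + norm (x :: 'a::euclidean_space)) powr (- real DIM('a))
      * (1 + ln (1 + norm x)) powr (- b)) \<partial>lborel) < \<infinity>"
proof -
  define K where "K = real DIM('a) * unit_ball_vol DIM('a)"
  have K: "K \<ge> 0" by (simp add: K_def)
  let ?f = "\<lambda>r. ennreal ((1 + r) powr (- real DIM('a)) * (1 + ln (1 + r)) powr (- b))"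
  have "(\<integral>\<^sup>+ x. ?f (norm (x :: 'a)) \<partial>lborel) = (\<integral>\<^sup>+ x. ?f (dist (0 :: 'a) x) \<partial>lborel)"
    by simp
  also have "\<dots> = (\<integral>\<^sup>+ r. ennreal (sphere_density TYPE('a) r) * ?f r \<partial>lborel)"
    by (rule nn_integral_dist) measurable
  also have "\<dots> \<le> (\<integral>\<^sup>+ r. ennreal (K * ((1 + ln (1 + r)) powr (- b) / (1 + r))) * indicator {0..} r \<partial>lborel)"
  proof (rule nn_integral_mono)
    fix r :: real
    have "r ^ (DIM('a) - 1) * (1 + r) powr (- real DIM('a)) \<le> 1 / (1 + r)" if "r \<ge> 0"
    proof -
      have "r ^ (DIM('a) - 1) \<le> (1 + r) ^ (DIM('a) - 1)"
        using that by (intro power_mono) auto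
      also have "\<dots> = (1 + r) powr (real DIM('a) - 1)"
        using that by (simp add: powr_realpow[symmetric] of_nat_diff)
      finally have "r ^ (DIM('a) - 1) * (1 + r) powr (- real DIM('a)) \<le>
        (1 + r) powr (real DIM('a) - 1) * (1 + r) powr (- real DIM('a))"
        by (rule mult_right_mono) simp
      also have "\<dots> = 1 / (1 + r)"
        using that by (subst powr_add[symmetric]) (simp add: powr_minus_divide)
      finally show ?thesis .
    qed
    from mult_right_mono[OF this, of "K * (1 + ln (1 + r)) powr (- b)"]
    show "ennreal (sphere_density TYPE('a) r) * ?f r \<le>
      ennreal (K * ((1 + ln (1 + r)) powr (- b) / (1 + r))) * indicator {0..} r"
      using K by (cases "r \<ge> 0")
        (auto simp: sphere_density_def K_def[symmetric] ennreal_mult[symmetric] mult_ac intro!: ennreal_leI)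
  qed
  also have "\<dots> = ennreal (0 - (- (K / (b - 1)) * (1 + ln (1 + 0)) powr (1 - b)))"
  proof (rule nn_integral_FTC_atLeast)
    fix r :: real assume r: "0 \<le> r"
    then have "ln (1 + r) \<ge> 0" by simp
    then have pos: "1 + ln (1 + r) > 0" by linarith
    have "((\<lambda>r. - (K / (b - 1)) * (1 + ln (1 + r)) powr (1 - b)) has_real_derivative
        - (K / (b - 1)) * (1 - b) * ((1 + ln (1 + r)) powr (- b) / (1 + r))) (at r)"
      using r pos assms by (auto intro!: derivative_eq_intros simp: mult_ac)
    also have "- (K / (b - 1)) * (1 - b) = K"
      using assms by (simp add: field_simps)
    finally show "((\<lambda>r. - (K / (b - 1)) * (1 + ln (1 + r)) powr (1 - b)) has_real_derivative
        K * ((1 + ln (1 + r)) powr (- b) / (1 + r))) (at r)" .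
    show "0 \<le> K * ((1 + ln (1 + r)) powr (- b) / (1 + r))"
      using K r by simp
  next
    have "((\<lambda>r::real. (1 + ln (1 + r)) powr (1 - b)) \<longlongrightarrow> 0) at_top"
      using assms by (intro tendsto_neg_powr filterlim_tendsto_add_at_top[OF tendsto_const]
          filterlim_compose[OF ln_at_top] filterlim_ident) auto
    from tendsto_mult_left[OF this, of "- (K / (b - 1))"]
    show "((\<lambda>r. - (K / (b - 1)) * (1 + ln (1 + r)) powr (1 - b)) \<longlongrightarrow> 0) at_top"
      by simp
  qed measurable
  also have "\<dots> < \<infinity>" by simp
  finally show ?thesis .
qed

lemma ennreal_powr_le:
  assumes "x \<le> ennreal z" "a \<ge> 0" "z \<ge> 0"
  shows "ennreal_powr x a \<le> ennreal (z powr a)"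
proof -
  have "x \<noteq> \<infinity>" using assms(1) by (auto simp: top_unique)
  moreover have "enn2real x \<le> z"
    using assms(1,3) by (metis enn2real_ennreal enn2real_mono ennreal_less_top)
  ultimately show ?thesis
    using assms by (auto simp: ennreal_powr_def intro!: ennreal_leI powr_mono2)
qed

section \<open>The slowly growing radial function\<close>

definition sqrt_log :: "'a::real_normed_vector \<Rightarrow> real" where
  "sqrt_log x = sqrt (1 + ln (1 + norm x))"

lemma sqrt_log_continuous: "continuous_on A sqrt_log"
  unfolding sqrt_log_def [abs_def]
  by (intro continuous_intros) (smt (verit) norm_ge_zero)

lemma sqrt_log_at_top:
  assumes "filterlim g at_infinity F"
  shows "filterlim (\<lambda>t. sqrt_log (g t)) at_top F"
  unfolding sqrt_log_def
  using assms
  by (intro filterlim_compose[OF sqrt_at_top] filterlim_tendsto_add_at_top[OF tendsto_const]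
      filterlim_compose[OF ln_at_top] filterlim_at_infinity_imp_norm_at_top)

text \<open>
  Rationalising, \<open>sqrt a - sqrt b = (a - b) / (sqrt a + sqrt b)\<close>, and the denominator is at least
  \<open>sqrt a\<close>. Discarding \<open>sqrt b\<close> makes the weight independent of \<open>y\<close>.
\<close>
lemma sqrt_log_diff_le:
  "\<bar>sqrt_log x - sqrt_log y\<bar> \<le>
    (1 + ln (1 + norm x)) powr (- 1/2) * \<bar>ln (1 + norm x) - ln (1 + norm y)\<bar>"
proof -
  define a where "a = 1 + ln (1 + norm x)"
  define b where "b = 1 + ln (1 + norm y)"
  have ab: "a \<ge> 1" "b \<ge> 1" by (simp_all add: a_def b_def)
  have "\<bar>sqrt a - sqrt b\<bar> * sqrt a \<le> \<bar>sqrt a - sqrt b\<bar> * (sqrt a + sqrt b)"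
    using ab by (intro mult_left_mono) auto
  also have "\<dots> = \<bar>(sqrt a - sqrt b) * (sqrt a + sqrt b)\<bar>"
    using ab by (simp add: abs_mult)
  also have "(sqrt a - sqrt b) * (sqrt a + sqrt b) = a - b"
    using ab by (simp add: algebra_simps)
  finally have "\<bar>sqrt a - sqrt b\<bar> \<le> a powr (- 1/2) * \<bar>a - b\<bar>"
    using ab by (simp add: powr_minus_divide powr_half_sqrt field_simps)
  then show ?thesis by (simp add: sqrt_log_def a_def b_def)
qed

text \<open>
  The inner integral is bounded by a multiple of
  \<open>(1 + ln r) powr (- q/2) * r powr (- (s * q))\<close> with \<open>r = 1 + norm x\<close>. Its power \<open>p / q\<close> is
  integrable: \<open>s * p \<ge> n\<close> makes the power of \<open>r\<close> at worst critical, and since \<open>s < 1\<close> and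
  \<open>n \<ge> 2\<close> force \<open>p > 2\<close>, the logarithmic factor has an exponent below \<open>-1\<close>.
\<close>
lemma sqrt_log_in_homogeneous_W:
  assumes "CARD('n::finite) \<ge> 2" and "0 < s" and "s < 1" and "0 < p" and "0 < q"
    and "s * p \<ge> real CARD('n)"
  shows "(sqrt_log :: real ^ 'n \<Rightarrow> real) \<in> homogeneous_W s p q"
proof -
  let ?L = "\<lambda>x :: real ^ 'n. 1 + ln (1 + norm x)"
  let ?N = "real CARD('n) + s * q"
  have "s * p < 1 * p" using assms by (intro mult_strict_right_mono) auto
  then have p: "p > 2" using assms by linarith
  obtain C where C: "C \<ge> 0" and le: "\<And>x :: real ^ 'n.
      (\<integral>\<^sup>+ y. ennreal (\<bar>ln (1 + norm x) - ln (1 + norm y)\<bar> powr q / dist x y powr ?N) \<partial>lborel)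
        \<le> ennreal (C * (1 + norm x) powr (- (s * q)))"
    using nn_integral_log_ratio_bound[where 'a = "real ^ 'n", of s q] assms by auto
  have inner: "(\<integral>\<^sup>+ y. ennreal (\<bar>sqrt_log x - sqrt_log y\<bar> powr q / norm (x - y) powr ?N) \<partial>lebesgue)
      \<le> ennreal (?L x powr (- q/2) * (C * (1 + norm x) powr (- (s * q))))" for x :: "real ^ 'n"
  proof -
    have "(\<integral>\<^sup>+ y. ennreal (\<bar>sqrt_log x - sqrt_log y\<bar> powr q / norm (x - y) powr ?N) \<partial>lborel)
      \<le> (\<integral>\<^sup>+ y. ennreal (?L x powr (- q/2)) *
            ennreal (\<bar>ln (1 + norm x) - ln (1 + norm y)\<bar> powr q / dist x y powr ?N) \<partial>lborel)"
    proof (rule nn_integral_mono)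
      fix y :: "real ^ 'n"
      have "\<bar>sqrt_log x - sqrt_log y\<bar> powr q \<le> (?L x powr (- 1/2) * \<bar>ln (1 + norm x) - ln (1 + norm y)\<bar>) powr q"
        using sqrt_log_diff_le assms by (intro powr_mono2) auto
      also have "\<dots> = ?L x powr (- q/2) * \<bar>ln (1 + norm x) - ln (1 + norm y)\<bar> powr q"
        by (simp add: powr_mult powr_powr)
      finally have "\<bar>sqrt_log x - sqrt_log y\<bar> powr q / norm (x - y) powr ?N
        \<le> ?L x powr (- q/2) * \<bar>ln (1 + norm x) - ln (1 + norm y)\<bar> powr q / norm (x - y) powr ?N"
        by (rule divide_right_mono) simp
      then show "ennreal (\<bar>sqrt_log x - sqrt_log y\<bar> powr q / norm (x - y) powr ?N) \<le> ennreal (?L x powr (- q/2)) *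
            ennreal (\<bar>ln (1 + norm x) - ln (1 + norm y)\<bar> powr q / dist x y powr ?N)"
        by (auto simp: ennreal_mult[symmetric] dist_norm intro!: ennreal_leI)
    qed
    also have "\<dots> = ennreal (?L x powr (- q/2)) *
        (\<integral>\<^sup>+ y. ennreal (\<bar>ln (1 + norm x) - ln (1 + norm y)\<bar> powr q / dist x y powr ?N) \<partial>lborel)"
      by (rule nn_integral_cmult) measurable
    also have "\<dots> \<le> ennreal (?L x powr (- q/2)) * ennreal (C * (1 + norm x) powr (- (s * q)))"
      by (intro mult_left_mono le) auto
    finally show ?thesis
      using C by (simp add: nn_integral_completion ennreal_mult)
  qed
  have "(\<integral>\<^sup>+ x. ennreal_powr
           (\<integral>\<^sup>+ y. ennreal (\<bar>sqrt_log (x :: real ^ 'n) - sqrt_log y\<bar> powr q / norm (x - y) powr ?N) \<partial>lebesgue)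
           (p / q) \<partial>lborel)
    \<le> (\<integral>\<^sup>+ x. ennreal (C powr (p/q)) * ennreal ((1 + norm (x :: real ^ 'n)) powr (- real CARD('n))
      * ?L x powr (- (p/2))) \<partial>lborel)"
  proof (rule nn_integral_mono)
    fix x :: "real ^ 'n"
    have "ennreal_powr
           (\<integral>\<^sup>+ y. ennreal (\<bar>sqrt_log x - sqrt_log y\<bar> powr q / norm (x - y) powr ?N) \<partial>lebesgue) (p / q)
      \<le> ennreal ((?L x powr (- q/2) * (C * (1 + norm x) powr (- (s * q)))) powr (p/q))"
      using assms C by (intro ennreal_powr_le inner) auto
    also have "(?L x powr (- q/2) * (C * (1 + norm x) powr (- (s * q)))) powr (p/q)
      = C powr (p/q) * ((1 + norm x) powr (- (s * p)) * ?L x powr (- (p/2)))"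
      using assms C by (simp add: powr_mult powr_powr)
    also have "ennreal \<dots> \<le> ennreal (C powr (p/q) * ((1 + norm x) powr (- real CARD('n)) * ?L x powr (- (p/2))))"
      using assms C by (intro ennreal_leI mult_left_mono mult_right_mono powr_mono) auto
    finally show "ennreal_powr
           (\<integral>\<^sup>+ y. ennreal (\<bar>sqrt_log x - sqrt_log y\<bar> powr q / norm (x - y) powr ?N) \<partial>lebesgue) (p / q)
      \<le> ennreal (C powr (p/q)) * ennreal ((1 + norm x) powr (- real CARD('n)) * ?L x powr (- (p/2)))"
      by (simp add: ennreal_mult)
  qed
  also have "\<dots> = ennreal (C powr (p/q)) * (\<integral>\<^sup>+ x. ennreal ((1 + norm (x :: real ^ 'n)) powr (- real CARD('n))
      * ?L x powr (- (p/2))) \<partial>lborel)"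
    by (rule nn_integral_cmult) measurable
  also have "\<dots> < \<infinity>"
    using nn_integral_log_weight_finite[of "p/2", where 'a = "real ^ 'n"] p
    by (simp add: ennreal_mult_less_top)
  finally have "(\<integral>\<^sup>+ x. ennreal_powr
           (\<integral>\<^sup>+ y. ennreal (\<bar>sqrt_log (x :: real ^ 'n) - sqrt_log y\<bar> powr q / norm (x - y) powr ?N) \<partial>lebesgue)
           (p / q) \<partial>lebesgue) < \<infinity>"
    by (simp only: nn_integral_completion)
  moreover have "(sqrt_log :: real ^ 'n \<Rightarrow> real) \<in> borel_measurable lebesgue"
    using borel_measurable_continuous_onI[OF sqrt_log_continuous]
    by (intro measurable_completion) simp
  ultimately show ?thesis
    by (simp add: homogeneous_W_def)
qed

theorem proposition1p7:
  fixes s p q :: real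
  assumes "CARD('n::finite) \<ge> 2"
    and "0 < s" and "s < 1"
    and "0 < p" and "0 < q"
    and "s * p \<ge> real CARD('n)"
  shows "\<exists>u :: real ^ 'n \<Rightarrow> real.
           continuous_on UNIV u \<and> u \<in> homogeneous_W s p q \<and>
           (\<forall>\<gamma> :: real \<Rightarrow> real ^ 'n.
              continuous_on {0..} \<gamma> \<and> \<gamma> 0 = 0 \<and> filterlim \<gamma> at_infinity at_top \<longrightarrow>
              filterlim (\<lambda>t. u (\<gamma> t)) at_top at_top)"
proof (intro exI conjI allI impI)
  show "continuous_on UNIV (sqrt_log :: real ^ 'n \<Rightarrow> real)"
    by (rule sqrt_log_continuous)
  show "(sqrt_log :: real ^ 'n \<Rightarrow> real) \<in> homogeneous_W s p q"
    using assms by (rule sqrt_log_in_homogeneous_W)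
  fix \<gamma> :: "real \<Rightarrow> real ^ 'n"
  assume "continuous_on {0..} \<gamma> \<and> \<gamma> 0 = 0 \<and> filterlim \<gamma> at_infinity at_top"
  then show "filterlim (\<lambda>t. sqrt_log (\<gamma> t)) at_top at_top"
    by (intro sqrt_log_at_top) simp
qed

end
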